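(* Let $\vec S$ be a submodular separation system without degenerate elements in a distributive universe $\vec U$ of separations. Then exactly one of the following holds: (i) $S$ has an abstract tangle. (ii) There exists an $S$-tree over $\mathcal T^*$ (witnessing that $S$ has no abstract tangle).
   Context: A separation system $(\vec S,\le,{}^* )$ is a partially ordered set with an order-reversing involution $^*:\vec S\to\vec S$. Its elements are called oriented separations. An (unoriented) separation is a set $s=\{\vec s,\vec s^{\,*}\}$; $S$ denotes the set of all these. $\vec s$ is degenerate if $\vec s=\vec s^{\,*}$. A universe of separations is a separation system $\vec U$ whose partial order is a lattice (join $\vee$, meet $\wedge$); it is distributive if this lattice is distributive. A separation system $\vec S$ in $\vec U$ is a subset of $\vec U$ closed under $^*$, with the induced order and involution. It is submodular if for all $\vec s,\vec t\in\vec S$ at least one of $\vec s\vee\vec t$, $\vec s\wedge\vec t$ (computed in $\vec U$) lies in $\vec S$. $\vec x\in\vec U$ is co-small if $\vec x^{\,*}\le\vec x$. An orientation of $S$ is a set $O\subseteq\vec S$ containing exactly one of $\vec s,\vec s^{\,*}$ for every $s\in S$. It is consistent if whenever $r,s\in S$ are distinct with orientations $\vec r\le\vec s\in O$, then $\vec r^{\,*}\notin O$. Let $\mathcal T$ be the set of all sets $\{\vec r,\vec s,\vec t\}\subseteq\vec U$ ($\vec r,\vec s,\vec t$ not necessarily distinct) such that $\vec r\vee\vec s\vee\vec t$ is co-small. An abstract tangle of $S$ is a consistent orientation $O$ of $S$ such that no subset of $O$ is an element of $\mathcal T$. A star is a set $\sigma$ of non-degenerate oriented separations such that $\vec s\le\vec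 t^{\,*}$ for any two distinct $\vec s,\vec t\in\sigma$; $\mathcal T^*$ is the set of all elements of $\mathcal T$ that are stars. An $S$-tree is a pair $(T,\alpha)$ of a tree $T$ and a map $\alpha$ from the set $\vec E(T)=\{(x,y): xy\in E(T)\}$ of orientations of edges of $T$ to $\vec S$ such that $\alpha(y,x)=\alpha(x,y)^*$ for all $xy\in E(T)$. For $\mathcal F\subseteq 2^{\vec U}$ it is an $S$-tree over $\mathcal F$ if $\alpha(F_t)\in\mathcal F$ for every node $t$ of $T$, where $F_t=\{(s,t): st\in E(T)\}$. *)

theory Defs
  imports "Graph_Theory.Digraph_Component"
begin

section \<open>Separation systems and universes\<close>

text \<open>
  A separation system consists of a partially ordered type together with its involution
  \<open>flip\<close>.  For a universe the order is the order of a type of class \<^class>\<open>lattice\<close>, and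
  for a distributive universe of class \<^class>\<open>distrib_lattice\<close>; join and meet are
  \<^const>\<open>sup\<close> and \<^const>\<open>inf\<close>.  Separation systems inside a universe are subsets of it.
\<close>

definition separation_system :: "('a::order \<Rightarrow> 'a) \<Rightarrow> bool" where
  "separation_system flip \<longleftrightarrow>
     (\<forall>x. flip (flip x) = x) \<and> (\<forall>x y. x \<le> y \<longrightarrow> flip y \<le> flip x)"

definition universe :: "('a::lattice \<Rightarrow> 'a) \<Rightarrow> bool" where
  "universe flip \<longleftrightarrow> separation_system flip"

definition distributive_universe :: "('a::distrib_lattice \<Rightarrow> 'a) \<Rightarrow> bool" where
  "distributive_universe flip \<longleftrightarrow> universe flip"

definition separation_system_in :: "('a::lattice \<Rightarrow> 'a) \<Rightarrow> 'a set \<Rightarrow> bool" where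
  "separation_system_in flip S \<longleftrightarrow> (\<forall>s\<in>S. flip s \<in> S)"

definition submodular :: "'a::lattice set \<Rightarrow> bool" where
  "submodular S \<longleftrightarrow> (\<forall>s\<in>S. \<forall>t\<in>S. sup s t \<in> S \<or> inf s t \<in> S)"

definition degenerate :: "('a \<Rightarrow> 'a) \<Rightarrow> 'a \<Rightarrow> bool" where
  "degenerate flip s \<longleftrightarrow> s = flip s"

definition co_small :: "('a::order \<Rightarrow> 'a) \<Rightarrow> 'a \<Rightarrow> bool" where
  "co_small flip x \<longleftrightarrow> flip x \<le> x"

text \<open>The unoriented separation underlying an oriented one, and the set of all of them.\<close>

definition unoriented :: "('a \<Rightarrow> 'a) \<Rightarrow> 'a \<Rightarrow> 'a set" where
  "unoriented flip s = {s, flip s}"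

definition separations :: "('a \<Rightarrow> 'a) \<Rightarrow> 'a set \<Rightarrow> 'a set set" where
  "separations flip S = unoriented flip ` S"


section \<open>Tangles\<close>

definition orientation :: "('a \<Rightarrow> 'a) \<Rightarrow> 'a set \<Rightarrow> 'a set \<Rightarrow> bool" where
  "orientation flip S O' \<longleftrightarrow> O' \<subseteq> S \<and> (\<forall>s\<in>separations flip S. \<exists>!x. x \<in> s \<and> x \<in> O')"

definition consistent :: "('a::order \<Rightarrow> 'a) \<Rightarrow> 'a set \<Rightarrow> 'a set \<Rightarrow> bool" where
  "consistent flip S O' \<longleftrightarrow>
     (\<forall>r\<in>S. \<forall>s\<in>S. unoriented flip r \<noteq> unoriented flip s \<and> r \<le> s \<and> s \<in> O'
        \<longrightarrow> flip r \<notin> O')"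

definition co_small_triples :: "('a::lattice \<Rightarrow> 'a) \<Rightarrow> 'a set set" where
  "co_small_triples flip = {{r, s, t} | r s t. co_small flip (sup (sup r s) t)}"

definition abstract_tangle :: "('a::lattice \<Rightarrow> 'a) \<Rightarrow> 'a set \<Rightarrow> 'a set \<Rightarrow> bool" where
  "abstract_tangle flip S O' \<longleftrightarrow>
     orientation flip S O' \<and> consistent flip S O' \<and> (\<forall>\<sigma>\<subseteq>O'. \<sigma> \<notin> co_small_triples flip)"

definition star :: "('a::order \<Rightarrow> 'a) \<Rightarrow> 'a set \<Rightarrow> bool" where
  "star flip \<sigma> \<longleftrightarrow>
     (\<forall>s\<in>\<sigma>. \<not> degenerate flip s) \<and> (\<forall>s\<in>\<sigma>. \<forall>t\<in>\<sigma>. s \<noteq> t \<longrightarrow> s \<le> flip t)"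

definition co_small_triple_stars :: "('a::lattice \<Rightarrow> 'a) \<Rightarrow> 'a set set" where
  "co_small_triple_stars flip = {\<sigma> \<in> co_small_triples flip. star flip \<sigma>}"


section \<open>Trees over sets of separations\<close>

text \<open>
  An undirected graph is represented by the symmetric digraph of the orientations of its edges,
  so that \<^term>\<open>parcs T\<close> is the set of all \<open>(x, y)\<close> with \<open>xy\<close> an edge; \<^const>\<open>pair_graph\<close>
  also makes it finite and loopless, and \<^const>\<open>connected\<close> makes it non-empty.  The constant
  \<^const>\<open>tree\<close> is not applicable, since it counts the directed 2-cycle formed by the two
  orientations of one edge as a cycle; the cycles of the undirected graph are the
  directed cycles of length at least 3.
\<close>

definition undirected_tree :: "'v pair_pre_digraph \<Rightarrow> bool" where
  "undirected_tree T \<longleftrightarrow>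
     pair_graph T \<and> connected T \<and> (\<nexists>p. pre_digraph.cycle T p \<and> 3 \<le> length p)"

definition s_tree ::
  "('a \<Rightarrow> 'a) \<Rightarrow> 'a set \<Rightarrow> 'v pair_pre_digraph \<Rightarrow> ('v \<times> 'v \<Rightarrow> 'a) \<Rightarrow> bool" where
  "s_tree flip S T \<alpha> \<longleftrightarrow>
     undirected_tree T \<and>
     (\<forall>(x, y)\<in>parcs T. \<alpha> (x, y) \<in> S \<and> \<alpha> (y, x) = flip (\<alpha> (x, y)))"

definition s_tree_over ::
  "('a \<Rightarrow> 'a) \<Rightarrow> 'a set \<Rightarrow> 'a set set \<Rightarrow> 'v pair_pre_digraph \<Rightarrow> ('v \<times> 'v \<Rightarrow> 'a) \<Rightarrow> bool" where
  "s_tree_over flip S \<F> T \<alpha> \<longleftrightarrow>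
     s_tree flip S T \<alpha> \<and> (\<forall>t\<in>pverts T. \<alpha> ` in_arcs T t \<in> \<F>)"

text \<open>
  As trees are finite, up to isomorphism their nodes are natural numbers.  This lets the
  existence of a tree be expressed by quantifying over trees on \<^typ>\<open>nat\<close>.
\<close>

definition has_s_tree_over :: "('a \<Rightarrow> 'a) \<Rightarrow> 'a set \<Rightarrow> 'a set set \<Rightarrow> bool" where
  "has_s_tree_over flip S \<F> \<longleftrightarrow>
     (\<exists>(T :: nat pair_pre_digraph) \<alpha>. s_tree_over flip S \<F> T \<alpha>)"

end

theory Submission
  imports Defs
begin

text \<open>
  A tangle orients the edges of an \<open>S\<close>-tree; the orientation has a sink, whose star would be
  contained in the tangle.  Conversely, let \<open>S\<close> be finite and suppose that there is no \<open>S\<close>-tree.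
  For a down-closed set \<open>A\<close> let \<open>forced A\<close> consist of the labels of the root edges of \<open>S\<close>-trees
  that may also use leaves in \<open>A\<close>, and take \<open>A\<close> maximal such that \<open>forced A\<close> contains no pair of
  inverses.  If \<open>A\<close> fails to orient \<open>x\<close>, then minimal elements \<open>r \<le> x\<close> and \<open>s \<le> x\<^sup>*\<close> outside \<open>A\<close> have
  their inverses forced.  Submodularity provides some \<open>c\<close> between \<open>r\<close> and \<open>s\<^sup>*\<close> to which the trees of
  \<open>r\<^sup>*\<close> and \<open>s\<^sup>*\<close> can both be shifted, so that \<open>c\<close> and \<open>c\<^sup>*\<close> are both forced, a contradiction.
  Hence \<open>A\<close> is a down-closed orientation, and a triple in \<open>A\<close> with co-small join could be uncrossed
  to a star.  Infinite \<open>S\<close> reduce to finite ones by compactness, because finitely generated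
  distributive lattices are finite.
\<close>

section \<open>Trees\<close>

text \<open>Without a sink, following arcs of \<open>Q\<close> would run into a cycle, and
  \<open>antisym\<close> makes this a cycle of the undirected tree.\<close>

lemma undirected_tree_sink:
  assumes tree: "undirected_tree T" and "Q \<subseteq> parcs T"
    and antisym: "\<And>x y. (x, y) \<in> Q \<Longrightarrow> (y, x) \<notin> Q"
  shows "\<exists>t\<in>pverts T. \<forall>y. (t, y) \<notin> Q"
proof (rule ccontr)
  assume "\<not> ?thesis"
  then have "\<forall>t\<in>pverts T. \<exists>y. (t, y) \<in> Q" by blast
  then obtain f where f: "\<And>t. t \<in> pverts T \<Longrightarrow> (t, f t) \<in> Q" by metis
  interpret T: pair_graph T using tree by (simp add: undirected_tree_def)
  define H where "H = T\<lparr>parcs := Q\<rparr>"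
  have H: "pverts H = pverts T" "parcs H = Q" by (simp_all add: H_def)
  interpret H: pair_wf_digraph H
    using T.in_arcsD1 T.in_arcsD2 \<open>Q \<subseteq> parcs T\<close> by unfold_locales (auto simp: H)
  have "pverts T \<noteq> {}"
    using tree by (auto simp: undirected_tree_def connected_def strongly_connected_def mk_symmetric_def)
  then obtain v where v: "v \<in> pverts T" by blast
  define g where "g i = (f ^^ i) v" for i
  have g: "g i \<in> pverts T" for i
  proof (induction i)
    case (Suc i)
    then show ?case using f[of "g i"] T.in_arcsD2 \<open>Q \<subseteq> parcs T\<close> by (auto simp: g_def)
  qed (simp add: g_def v)
  have step: "(g i, g (Suc i)) \<in> Q" for i using f[OF g[of i]] by (simp add: g_def)
  have walk: "H.awalk (g i) (map (\<lambda>k. (g k, g (Suc k))) [i..<i + d]) (g (i + d))" for i d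
  proof (induction d)
    case 0
    show ?case by (simp add: H.awalk_Nil_iff H g)
  next
    case (Suc d)
    moreover have "H.awalk (g (i + d)) [(g (i + d), g (Suc (i + d)))] (g (Suc (i + d)))"
      using step by (simp add: H.awalk_simps H g)
    ultimately show ?case by auto
  qed
  have "\<not> inj g"
    using finite_subset[of "range g", OF _ T.pair_finite_verts] g
    by (auto dest: finite_imageD)
  then obtain i j where "g i = g j" "i < j" by (metis injI linorder_neqE_nat)
  then have "H.closed_w (map (\<lambda>k. (g k, g (Suc k))) [i..<j])"
    using walk[of i "j - i"] by (auto simp: H.closed_w_def)
  then obtain p where "H.cycle p" using H.closed_w_imp_cycle by blast
  then obtain u where p: "H.awalk u p u" "distinct (tl (pawalk_verts u p))" "p \<noteq> []"
    by (auto simp: H.cycle_def)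
  have "T.awalk u p u" using p(1) \<open>Q \<subseteq> parcs T\<close> by (auto simp: H.awalk_def T.awalk_def H)
  with p have "T.cycle p" by (auto simp: T.cycle_def)
  \<comment> \<open>A shorter cycle would contain an arc together with its reverse; a loop is its
    own reverse.\<close>
  moreover have "3 \<le> length p"
  proof (rule ccontr)
    assume "\<not> 3 \<le> length p"
    then have "length p = 1 \<or> length p = 2" using p(3) length_0_conv[of p] by linarith
    then show False
    proof
      assume "length p = 1"
      then obtain e where "p = [e]" by (auto simp: length_Suc_conv)
      with p(1) show False using antisym[of u u] by (cases e) (auto simp: H.awalk_def H)
    next
      assume "length p = 2"
      then obtain e e' where "p = [e, e']" by (auto simp: length_Suc_conv numeral_2_eq_2)
      with p(1) show False using antisym
        by (cases e; cases e') (auto simp: H.awalk_def H)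
    qed
  qed
  ultimately show False using tree by (auto simp: undirected_tree_def)
qed

section \<open>Trees given by parent functions\<close>

definition parent_graph :: "nat \<Rightarrow> (nat \<Rightarrow> nat) \<Rightarrow> nat pair_pre_digraph" where
  "parent_graph n p = \<lparr> pverts = {..<n},
     parcs = {(v, p v) | v. 0 < v \<and> v < n} \<union> {(p v, v) | v. 0 < v \<and> v < n} \<rparr>"

lemma pcas_nth_Suc: "pcas u w v \<Longrightarrow> Suc i < length w \<Longrightarrow> fst (w ! Suc i) = snd (w ! i)"
proof (induction w arbitrary: u i)
  case (Cons e w)
  then show ?case by (cases i; cases w) auto
qed simp

lemma pcas_closed: "pcas u w v \<Longrightarrow> w \<noteq> [] \<Longrightarrow> fst (hd w) = u \<and> snd (last w) = v"
  by (induction w arbitrary: u) auto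

lemma pawalk_verts_tl: "w \<noteq> [] \<Longrightarrow> pcas u w v \<Longrightarrow> tl (pawalk_verts u w) = map snd w"
proof (induction w arbitrary: u)
  case (Cons e w)
  then show ?case by (cases w) auto
qed simp

text \<open>At the largest vertex of a cycle both neighbours are its parent, so the cycle has length 2.\<close>

lemma undirected_tree_parent_graph:
  assumes "0 < n" and less: "\<And>v. 0 < v \<Longrightarrow> v < n \<Longrightarrow> p v < v"
  shows "undirected_tree (parent_graph n p)"
proof -
  let ?G = "parent_graph n p"
  have verts: "pverts ?G = {..<n}" by (simp add: parent_graph_def)
  have arcs: "(x, y) \<in> parcs ?G \<longleftrightarrow> (0 < x \<and> x < n \<and> y = p x) \<or> (0 < y \<and> y < n \<and> x = p y)" for x y
    by (auto simp: parent_graph_def)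
  have in_verts: "x < n \<and> y < n" if "(x, y) \<in> parcs ?G" for x y
    using that less[of x] less[of y] unfolding arcs by auto
  have graph: "pair_graph ?G"
  proof
    show "fst e \<in> pverts ?G" if "e \<in> parcs ?G" for e
      using that in_verts[of "fst e" "snd e"] by (auto simp: verts)
    show "snd e \<in> pverts ?G" if "e \<in> parcs ?G" for e
      using that in_verts[of "fst e" "snd e"] by (auto simp: verts)
    show "finite (pverts ?G)" by (simp add: verts)
    have "parcs ?G \<subseteq> {..<n} \<times> {..<n}" using in_verts by auto
    then show "finite (parcs ?G)" by (rule finite_subset) simp
    show "symmetric ?G" by (auto simp: symmetric_def sym_def arcs)
    show "fst e \<noteq> snd e" if "e \<in> parcs ?G" for e
      using that arcs[of "fst e" "snd e"] by (metis less less_irrefl prod.collapse)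
  qed
  then interpret G: pair_graph ?G .
  have root: "v \<rightarrow>\<^sup>*\<^bsub>?G\<^esub> 0" if "v < n" for v
    using that
  proof (induction v rule: less_induct)
    case (less v)
    show ?case
    proof (cases "v = 0")
      case True
      then show ?thesis using less.prems by (simp add: verts)
    next
      case False
      then have "p v < v" using assms(2) less.prems by simp
      moreover have "(v, p v) \<in> parcs ?G" using False less.prems by (simp add: arcs)
      ultimately show ?thesis using less.IH[of "p v"] less.prems
        by (metis G.adj_reachable_trans order.strict_trans)
    qed
  qed
  have "connected ?G"
    unfolding connected_def
  proof
    show "verts (mk_symmetric ?G) \<noteq> {}" using \<open>0 < n\<close> by (auto simp: verts)
    fix u v assume "u \<in> verts (mk_symmetric ?G)" "v \<in> verts (mk_symmetric ?G)"
    then have "u < n" "v < n" by (auto simp: verts)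
    then have "u \<rightarrow>\<^sup>*\<^bsub>?G\<^esub> v"
      using root symmetric_reachable[OF G.sym_arcs root[of v]] G.reachable_trans by blast
    then show "u \<rightarrow>\<^sup>*\<^bsub>with_proj (mk_symmetric ?G)\<^esub> v" by (rule G.reachable_mk_symmetricI)
  qed
  moreover have False if w: "G.cycle w" "3 \<le> length w" for w
  proof -
    obtain u where "G.awalk u w u" and dist: "distinct (tl (pawalk_verts u w))" and "w \<noteq> []"
      using w(1) by (auto simp: G.cycle_def)
    then have cas: "pcas u w u" and sub: "set w \<subseteq> parcs ?G" by (auto simp: G.awalk_def)
    \<comment> \<open>Indices are read modulo the length, so that \<open>h\<close> runs around the
      cycle forever.\<close>
    define m where "m = length w"
    have m: "3 \<le> m" using w by (simp add: m_def)
    then have lt: "i mod m < m" for i by (intro mod_less_divisor) simp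
    define h where "h i = snd (w ! (i mod m))" for i
    have dist: "distinct (map snd w)" using dist pawalk_verts_tl[OF \<open>w \<noteq> []\<close> cas] by simp
    have inj: "i mod m = j mod m" if "h i = h j" for i j
      using nth_eq_iff_index_eq[OF dist, of "i mod m" "j mod m"] that lt[of i] lt[of j]
      by (simp add: h_def m_def)
    have arc: "(h i, h (Suc i)) \<in> parcs ?G" for i
    proof -
      have "fst (w ! (Suc i mod m)) = h i"
      proof (cases "Suc (i mod m) = m")
        case True
        then have "Suc i mod m = 0" by (simp add: mod_Suc)
        moreover have "i mod m = m - 1" using True by simp
        ultimately show ?thesis using pcas_closed[OF cas \<open>w \<noteq> []\<close>] \<open>w \<noteq> []\<close>
          by (simp add: h_def m_def hd_conv_nth last_conv_nth)
      next
        case False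
        then have "Suc (i mod m) < m" using lt[of i] by (simp add: Suc_lessI)
        then show ?thesis using pcas_nth_Suc[OF cas] False by (simp add: h_def m_def mod_Suc)
      qed
      moreover have "w ! (Suc i mod m) \<in> parcs ?G"
        using sub nth_mem[of "Suc i mod m" w] lt[of "Suc i"] by (auto simp: m_def)
      ultimately show ?thesis by (metis h_def prod.collapse)
    qed
    have "finite (range h)" using in_verts[OF arc] by (auto intro: finite_subset[OF _ finite_lessThan[of n]])
    then obtain k where k: "\<And>i. h i \<le> h k"
      using Max_in[of "range h"] Max_ge[of "range h"] by (metis UNIV_not_empty image_iff image_is_empty rangeI)
    \<comment> \<open>The cyclic predecessor of \<open>k\<close>; adding \<open>m\<close> avoids
      truncated subtraction at \<open>k = 0\<close>.\<close>
    define i where "i = k + m - 1"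
    have "h (Suc i) = h k" using m by (simp add: h_def i_def)
    moreover have "h i = p (h (Suc i))"
      using arc[of i] k[of i] less[of "h i"] \<open>h (Suc i) = h k\<close> unfolding arcs by auto
    moreover have "h (Suc (Suc i)) = p (h (Suc i))"
      using arc[of "Suc i"] k[of "Suc (Suc i)"] less[of "h (Suc (Suc i))"] \<open>h (Suc i) = h k\<close>
      unfolding arcs by auto
    ultimately have "i mod m = Suc (Suc i) mod m" by (intro inj) simp
    then have "m dvd Suc (Suc i) - i" using mod_eq_dvd_iff_nat[of i "Suc (Suc i)" m] by simp
    then have "m dvd 2" by (simp add: numeral_2_eq_2)
    then show False using m by (auto dest: dvd_imp_le)
  qed
  ultimately show ?thesis using graph by (auto simp: undirected_tree_def)
qed

lemma has_s_tree_over_mono: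
  assumes "S \<subseteq> S'" "has_s_tree_over flip S F"
  shows "has_s_tree_over flip S' F"
  using assms unfolding has_s_tree_over_def s_tree_over_def s_tree_def by blast

section \<open>Finitely generated distributive lattices\<close>

inductive_set sublattice :: "'a::lattice set \<Rightarrow> 'a set" for G where
  base: "x \<in> G \<Longrightarrow> x \<in> sublattice G"
| sup: "x \<in> sublattice G \<Longrightarrow> y \<in> sublattice G \<Longrightarrow> sup x y \<in> sublattice G"
| inf: "x \<in> sublattice G \<Longrightarrow> y \<in> sublattice G \<Longrightarrow> inf x y \<in> sublattice G"

text \<open>Disjunctive normal form: by distributivity every element is a join of meets of
  generators, and only finitely many such expressions exist.\<close>

lemma finite_sublattice:
  fixes G :: "'a::distrib_lattice set"
  assumes "finite G"
  shows "finite (sublattice G)"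
proof -
  define M where "M = Inf_fin ` {A. A \<subseteq> G \<and> A \<noteq> {}}"
  define J where "J = Sup_fin ` {B. B \<subseteq> M \<and> B \<noteq> {}}"
  have fin: "finite M" unfolding M_def using assms by simp
  then have "finite J" unfolding J_def by simp
  have M_inf: "inf x y \<in> M" if xy: "x \<in> M" "y \<in> M" for x y
  proof -
    obtain A B where AB: "A \<subseteq> G" "A \<noteq> {}" "x = Inf_fin A" "B \<subseteq> G" "B \<noteq> {}" "y = Inf_fin B"
      using xy by (auto simp: M_def)
    then have "inf x y = Inf_fin (A \<union> B)"
      using assms by (simp add: Inf_fin.union finite_subset)
    with AB show ?thesis by (auto simp: M_def)
  qed
  have "x \<in> J" if "x \<in> sublattice G" for x
    using that
  proof induction
    case (base x)
    have "Inf_fin {x} \<in> M" using base by (auto simp: M_def simp del: Inf_fin.singleton)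
    then have "Sup_fin {x} \<in> J" by (auto simp: J_def simp del: Sup_fin.singleton)
    then show ?case by simp
  next
    case (sup x y)
    then obtain A B where AB: "A \<subseteq> M" "A \<noteq> {}" "x = Sup_fin A" "B \<subseteq> M" "B \<noteq> {}" "y = Sup_fin B"
      by (auto simp: J_def)
    then have "sup x y = Sup_fin (A \<union> B)"
      using fin by (simp add: Sup_fin.union finite_subset)
    with AB show ?case by (auto simp: J_def)
  next
    case (inf x y)
    then obtain A B where AB: "A \<subseteq> M" "A \<noteq> {}" "x = Sup_fin A" "B \<subseteq> M" "B \<noteq> {}" "y = Sup_fin B"
      by (auto simp: J_def)
    then have "inf x y = Sup_fin {inf a b | a b. a \<in> A \<and> b \<in> B}"
      using fin by (simp add: inf_Sup2_distrib finite_subset)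
    moreover have "{inf a b | a b. a \<in> A \<and> b \<in> B} \<subseteq> M" using AB M_inf by blast
    ultimately show ?case using AB by (auto simp: J_def)
  qed
  then show ?thesis using \<open>finite J\<close> by (auto intro: finite_subset)
qed

section \<open>Forced separations\<close>

lemma sup3_cong:
  fixes a b c r s t :: "'a::lattice"
  assumes "{a, b, c} = {r, s, t}"
  shows "sup (sup a b) c = sup (sup r s) t"
proof -
  have "Sup_fin {a, b, c} = Sup_fin {r, s, t}" using assms by simp
  then show ?thesis by (simp add: sup_assoc)
qed

lemma co_small_triples_iff:
  "{a, b, c} \<in> co_small_triples flip \<longleftrightarrow> co_small flip (sup (sup a b) c)"
proof
  assume "{a, b, c} \<in> co_small_triples flip"
  then obtain r s t where "{a, b, c} = {r, s, t}" "co_small flip (sup (sup r s) t)"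
    by (auto simp: co_small_triples_def)
  then show "co_small flip (sup (sup a b) c)" using sup3_cong[of a b c r s t] by simp
qed (auto simp: co_small_triples_def)

text \<open>For sets that contain an orientation of each separation, this is all that being a tangle
  amounts to, see \<open>abstract_tangle_iff\<close>.\<close>

definition avoiding :: "('a::lattice \<Rightarrow> 'a) \<Rightarrow> 'a set \<Rightarrow> bool" where
  "avoiding flip A \<longleftrightarrow> (\<forall>r\<in>A. \<forall>s\<in>A. \<forall>t\<in>A. \<not> co_small flip (sup (sup r s) t))"

locale separations_in_universe =
  fixes flip :: "'u::distrib_lattice \<Rightarrow> 'u" and S :: "'u set"
  assumes flip_flip [simp]: "flip (flip x) = x"
    and flip_mono: "x \<le> y \<Longrightarrow> flip y \<le> flip x"
    and flip_in: "s \<in> S \<Longrightarrow> flip s \<in> S"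
    and submod: "s \<in> S \<Longrightarrow> t \<in> S \<Longrightarrow> sup s t \<in> S \<or> inf s t \<in> S"
    and nondegenerate: "s \<in> S \<Longrightarrow> flip s \<noteq> s"
begin

lemma flip_le_iff [simp]: "flip x \<le> flip y \<longleftrightarrow> y \<le> x"
  by (metis flip_flip flip_mono)

lemma flip_le_swap: "flip x \<le> y \<longleftrightarrow> flip y \<le> x" "x \<le> flip y \<longleftrightarrow> y \<le> flip x"
  by (metis flip_flip flip_mono)+

lemma flip_in_iff [simp]: "flip x \<in> S \<longleftrightarrow> x \<in> S"
  by (metis flip_flip flip_in)

lemma flip_sup: "flip (sup x y) = inf (flip x) (flip y)"
proof (rule antisym)
  have "sup x y \<le> flip (inf (flip x) (flip y))"
    using flip_le_swap(2)[of x "inf (flip x) (flip y)"] flip_le_swap(2)[of y "inf (flip x) (flip y)"]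
    by simp
  then show "inf (flip x) (flip y) \<le> flip (sup x y)" by (simp add: flip_le_swap(2))
qed (simp add: flip_mono)

lemma flip_inf: "flip (inf x y) = sup (flip x) (flip y)"
  by (metis flip_flip flip_sup)

lemma co_small_sup_flip: "co_small flip (sup x (flip x))"
  by (simp add: co_small_def flip_sup le_supI1)

lemma co_small_mono: "co_small flip x \<Longrightarrow> x \<le> y \<Longrightarrow> co_small flip y"
  unfolding co_small_def by (meson flip_mono order_trans)

text \<open>The inverse is the join of \<open>flip x\<close> and \<open>inf (flip y) y\<close>, and
  both lie below \<open>x\<close> and below \<open>sup y (flip y)\<close>. Shifting and uncrossing
  both preserve co-smallness for this reason.\<close>

lemma co_small_inf_sup_flip:
  assumes "co_small flip x" "y \<le> x"
  shows "co_small flip (inf x (sup y (flip y)))"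
proof -
  have "flip x \<le> flip y" "flip x \<le> x" using assms by (simp_all add: co_small_def flip_mono)
  moreover have "inf (flip y) y \<le> x" using assms(2) by (rule le_infI2)
  ultimately show ?thesis by (simp add: co_small_def flip_sup flip_inf le_infI1 le_supI1 le_supI2)
qed

abbreviation "stars \<equiv> co_small_triple_stars flip"

lemma stars_iff:
  assumes "a \<in> S" "b \<in> S" "c \<in> S"
  shows "{a, b, c} \<in> stars \<longleftrightarrow> co_small flip (sup (sup a b) c) \<and>
    (a = b \<or> a \<le> flip b) \<and> (a = c \<or> a \<le> flip c) \<and> (b = c \<or> b \<le> flip c)"
  using assms nondegenerate[symmetric]
  by (auto simp: co_small_triple_stars_def co_small_triples_iff star_def degenerate_def flip_le_swap)

text \<open>The labels of the edges into the roots of subtrees of \<open>S\<close>-trees that may also use as leaves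
  the edges with a label from \<open>A\<close>; orientations that contain \<open>A\<close> and avoid \<open>\<T>\<^sup>*\<close> contain all
  of them.\<close>

inductive_set forced :: "'u set \<Rightarrow> 'u set" for A where
  base: "x \<in> A \<Longrightarrow> x \<in> forced A"
| step: "x \<in> S \<Longrightarrow> y \<in> S \<Longrightarrow> z \<in> S \<Longrightarrow> {flip x, y, z} \<in> stars \<Longrightarrow>
    y = flip x \<or> y \<in> forced A \<Longrightarrow> z = flip x \<or> z \<in> forced A \<Longrightarrow> x \<in> forced A"

text \<open>Two trees with inverse root labels can be glued along their root edge into a single
  tree.\<close>

definition inconsistent :: "'u set \<Rightarrow> bool" where
  "inconsistent A \<longleftrightarrow> (\<exists>x. x \<in> forced A \<and> flip x \<in> forced A)"

lemma forced_subset: "A \<subseteq> S \<Longrightarrow> x \<in> forced A \<Longrightarrow> x \<in> S"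
  by (rotate_tac, induction rule: forced.induct) auto

text \<open>Trees witnessing the elements of \<open>A\<close> are grafted onto the leaves.\<close>

lemma forced_trans:
  assumes "A \<subseteq> forced B" "x \<in> forced A"
  shows "x \<in> forced B"
  using assms(2) by induction (use assms(1) forced.step in blast)+

text \<open>The singleton of \<open>flip r\<close> is already a star with co-small join, so a tree
  with one node suffices.\<close>

lemma forced_small:
  assumes "r \<in> S" "r \<le> flip r"
  shows "r \<in> forced A"
proof -
  have "{flip r, flip r, flip r} \<in> stars"
    using assms by (subst stars_iff) (auto simp: co_small_def)
  then show ?thesis using assms by (auto intro: forced.step[of _ "flip r" "flip r"])
qed

text \<open>Re-rooting a tree at its leaf \<open>r\<close>: as \<open>r\<close> is not small, the order along paths between leaves
  shows that \<open>r\<close> is used by at most one leaf.\<close>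

lemma forced_insert_cases:
  assumes "A \<subseteq> S" "r \<in> S" "\<not> r \<le> flip r" "x \<in> forced (insert r A)"
  shows "x \<in> forced A \<or> (r \<le> x \<and> (flip x \<in> forced A \<longrightarrow> flip r \<in> forced A))"
  using assms(4)
proof induction
  case (base x)
  then show ?case by (auto intro: forced.base)
next
  case (step x y z)
  have star: "y = flip x \<or> y \<le> x" "z = flip x \<or> z \<le> x" "y = z \<or> y \<le> flip z"
    using step.hyps(4) stars_iff[of "flip x" y z] step.hyps(1-3) by (auto simp: flip_le_swap(1))
  \<comment> \<open>The re-rooting step: the same star is read with \<open>u\<close> instead of
    \<open>flip x\<close> as its root label.\<close>
  have turn: "flip u \<in> forced A"
    if "{flip x, u, v} \<in> stars" "u \<in> S" "v \<in> S" "flip x \<in> forced A" "v = flip x \<or> v \<in> insert u (forced A)" for u v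
    using forced.step[of "flip u" "flip x" v A] that step.hyps(1) by (auto simp: insert_commute)
  have yx: "{flip x, z, y} \<in> stars" using step.hyps(4) by (simp add: insert_commute)
  \<comment> \<open>Distinguished is which branches need the leaf \<open>r\<close>: none, only
    \<open>y\<close> or only \<open>z\<close> (up to \<open>y = z\<close>), or two different ones.
    The last case gives \<open>r \<le> y \<le> flip z \<le> flip r\<close>.\<close>
  consider "y = flip x \<or> y \<in> forced A" "z = flip x \<or> z \<in> forced A"
    | "y \<noteq> flip x" "y \<notin> forced A" "z = flip x \<or> z \<in> insert y (forced A)"
    | "z \<noteq> flip x" "z \<notin> forced A" "y = flip x \<or> y \<in> insert z (forced A)"
    | "y \<noteq> flip x" "y \<notin> forced A" "z \<noteq> flip x" "z \<notin> forced A" "y \<noteq> z"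
    by blast
  then show ?case
  proof cases
    case 1
    then show ?thesis using forced.step[OF step.hyps(1-4)] by blast
  next
    case 2
    then have "r \<le> y" "flip y \<in> forced A \<longrightarrow> flip r \<in> forced A" using step.IH by auto
    then show ?thesis using 2 star turn[OF step.hyps(4) step.hyps(2,3)] by (meson order_trans)
  next
    case 3
    then have "r \<le> z" "flip z \<in> forced A \<longrightarrow> flip r \<in> forced A" using step.IH by auto
    then show ?thesis using 3 star turn[OF yx step.hyps(3,2)] by (meson order_trans)
  next
    case 4
    then have "r \<le> y" "r \<le> z" "y \<le> flip z" using step.IH star by auto
    then have "r \<le> flip r" by (meson flip_mono order_trans)
    then show ?thesis using assms(3) by blast
  qed
qed

text \<open>A small \<open>r\<close> is forced anyway. Otherwise \<open>r\<close> cannot lie below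
  both \<open>x\<close> and \<open>flip x\<close>, so one of the two trees avoids the leaf
  \<open>r\<close>, and if the other one needs it, re-rooting there yields
  \<open>flip r\<close>.\<close>

lemma inconsistent_insertD:
  assumes "A \<subseteq> S" "r \<in> S" "inconsistent (insert r A)"
  shows "inconsistent A \<or> flip r \<in> forced A"
proof (cases "r \<le> flip r")
  case True
  then have "insert r A \<subseteq> forced A" using forced_small[OF assms(2)] by (auto intro: forced.base)
  then show ?thesis using assms(3) forced_trans unfolding inconsistent_def by blast
next
  case False
  obtain x where x: "x \<in> forced (insert r A)" "flip x \<in> forced (insert r A)"
    using assms(3) by (auto simp: inconsistent_def)
  have "\<not> (r \<le> x \<and> r \<le> flip x)" using False by (meson flip_le_swap(2) order_trans)
  with forced_insert_cases[OF assms(1,2) False x(1)] forced_insert_cases[OF assms(1,2) False x(2)]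
  show ?thesis by (auto simp: inconsistent_def)
qed

section \<open>Shifting trees\<close>

text \<open>The separations \<open>c\<close> to which every tree with root edge below \<open>s\<close> can be shifted.\<close>

definition shiftable :: "'u \<Rightarrow> 'u \<Rightarrow> bool" where
  "shiftable c s \<longleftrightarrow> (\<forall>y\<in>S. y \<le> s \<longrightarrow> inf y c \<in> S)"

text \<open>All labels directed towards the root are met with \<open>c\<close>. Down-closure keeps
  the leaves in \<open>A\<close>, and distributivity keeps the stars in \<T>*.\<close>

lemma forced_shift:
  assumes "A \<subseteq> S" and down: "\<And>x y. x \<in> A \<Longrightarrow> y \<in> S \<Longrightarrow> y \<le> x \<Longrightarrow> y \<in> A"
    and c: "shiftable c s" and "x \<in> forced A" "x \<le> s"
  shows "inf x c \<in> forced A"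
  using assms(4,5)
proof induction
  case (base x)
  then have "inf x c \<in> A" using c down[of x "inf x c"] \<open>A \<subseteq> S\<close> by (auto simp: shiftable_def)
  then show ?case by (rule forced.base)
next
  case (step x y z)
  have star: "y = flip x \<or> y \<le> x" "z = flip x \<or> z \<le> x" "y = z \<or> y \<le> flip z"
    and w: "co_small flip (sup (sup (flip x) y) z)"
    using step.hyps(4) stars_iff[of "flip x" y z] step.hyps(1-3) by (auto simp: flip_le_swap(1))
  define x' where "x' = inf x c"
  \<comment> \<open>The image of the star at the root. The label \<open>flip x\<close> points away
    from the root and so becomes \<open>flip x'\<close>, also when \<open>y\<close> or
    \<open>z\<close> equals it.\<close>
  define f where "f u = (if u = flip x then flip x' else inf u c)" for u
  have x': "x' \<in> S" using c step.hyps(1) step.prems by (auto simp: shiftable_def x'_def)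
  have S: "f u \<in> S" if "u \<in> S" "u = flip x \<or> u \<le> x" for u
    using that c x' step.prems order_trans by (auto simp: f_def shiftable_def)
  have forced: "f u = flip x' \<or> f u \<in> forced A"
    if "u = flip x \<or> u \<in> forced A \<and> (u \<le> s \<longrightarrow> inf u c \<in> forced A)" "u = flip x \<or> u \<le> x" for u
    using that step.prems order_trans by (auto simp: f_def)
  have le: "f u = flip x' \<or> f u \<le> x'" if "u = flip x \<or> u \<le> x" for u
    using that by (auto simp: f_def x'_def le_infI1)
  have fyz: "f y = f z \<or> f y \<le> flip (f z)"
  proof -
    consider "y = z" | "y = flip x" | "z = flip x" | "y \<noteq> flip x" "z \<noteq> flip x" "y \<le> flip z"
      using star by blast
    then show ?thesis
    proof cases
      case 2
      then show ?thesis using le[OF star(2)] by (auto simp: f_def)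
    next
      case 3
      then show ?thesis using le[OF star(1)] by (auto simp: f_def)
    next
      case 4
      then show ?thesis by (simp add: f_def flip_inf le_infI1 le_supI1)
    qed simp
  qed
  \<comment> \<open>Joined with \<open>flip x'\<close>, both cases of \<open>f\<close> become a meet
    with \<open>x'\<close>, which lets distributivity compute the new join.\<close>
  have fsup: "sup (flip x') (f u) = sup (flip x') (inf u x')" if "u = flip x \<or> u \<le> x" for u
  proof (cases "u = flip x")
    case True
    have "inf (flip x) x' \<le> flip x'" by (rule le_infI1) (simp add: x'_def)
    then show ?thesis using True by (simp add: f_def sup_absorb1)
  next
    case False
    then have "inf u c = inf u x'" using that by (simp add: x'_def inf_absorb1 flip: inf_assoc)
    then show ?thesis using False by (simp add: f_def)
  qed
  have "sup (sup (flip x') (f y)) (f z) = sup (sup (flip x') (f y)) (sup (flip x') (f z))"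
    by (simp add: sup_assoc sup_left_commute)
  also have "\<dots> = sup (flip x') (inf (sup y z) x')"
    by (simp add: fsup star inf_sup_distrib2 sup_assoc sup_left_commute)
  also have "\<dots> = inf (sup (flip x') (sup y z)) (sup (flip x') x')"
    by (simp add: sup_inf_distrib1)
  finally have "sup (sup (flip x') (f y)) (f z) =
    inf (sup (flip x') (sup y z)) (sup (flip x') (flip (flip x')))" by simp
  moreover have "co_small flip (sup (flip x') (sup y z))"
    using w by (rule co_small_mono) (simp add: x'_def sup_assoc le_supI1 flip_mono)
  ultimately have "co_small flip (sup (sup (flip x') (f y)) (f z))"
    using co_small_inf_sup_flip[of "sup (flip x') (sup y z)" "flip x'"] by simp
  then have "{flip x', f y, f z} \<in> stars"
    using le[OF star(1)] le[OF star(2)] fyz S[OF step.hyps(2) star(1)] S[OF step.hyps(3) star(2)] x'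
    by (subst stars_iff) (auto simp: flip_le_swap)
  then have "x' \<in> forced A"
    using S[OF step.hyps(2) star(1)] S[OF step.hyps(3) star(2)] x' forced[OF _ star(1)]
      forced[OF _ star(2)] step.IH
    by (intro forced.step[of x' "f y" "f z"]) auto
  then show ?case by (simp add: x'_def)
qed

text \<open>A minimal \<open>c\<close> that is shiftable from the side of \<open>s\<close> is
  shiftable from the side of \<open>r\<close> as well; a maximal counterexample could be
  enlarged.\<close>

lemma shiftable_between:
  assumes "finite S" "r \<in> S" "s \<in> S" "r \<le> s"
  obtains c where "c \<in> S" "r \<le> c" "c \<le> s" "shiftable c s" "shiftable (flip c) (flip r)"
proof -
  let ?C = "{c \<in> S. r \<le> c \<and> c \<le> s \<and> shiftable c s}"
  have "s \<in> ?C" using assms by (auto simp: shiftable_def inf_absorb1)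
  then obtain c where c: "c \<in> ?C" and min: "\<And>b. b \<in> ?C \<Longrightarrow> b \<le> c \<Longrightarrow> b = c"
    using finite_has_minimal[of ?C] \<open>finite S\<close> by auto
  \<comment> \<open>Under \<open>flip\<close> this is the second shiftability.\<close>
  have "sup t c \<in> S" if "t \<in> S" "r \<le> t" for t
  proof (rule ccontr)
    let ?B = "{t \<in> S. r \<le> t \<and> sup t c \<notin> S}"
    assume "sup t c \<notin> S"
    with that have "t \<in> ?B" by simp
    then obtain t where t: "t \<in> ?B" and max: "\<And>b. b \<in> ?B \<Longrightarrow> t \<le> b \<Longrightarrow> t = b"
      using finite_has_maximal[of ?B] \<open>finite S\<close> by auto
    have "inf t c \<in> S" using submod[of t c] t c by auto
    moreover have "inf t c \<noteq> c" using t by (auto simp: le_iff_inf sup_absorb1 inf_commute)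
    ultimately have "\<not> shiftable (inf t c) s"
      using min[of "inf t c"] t c by (auto simp: le_infI2)
    then obtain y where y: "y \<in> S" "y \<le> s" "inf y (inf t c) \<notin> S" by (auto simp: shiftable_def)
    \<comment> \<open>Minimality of \<open>c\<close> supplied \<open>y\<close>. Now
      \<open>u \<le> c\<close>, so \<open>sup u t\<close> has the same join with \<open>c\<close> as
      \<open>t\<close> and is a strictly larger counterexample.\<close>
    define u where "u = inf y c"
    have u: "u \<in> S" using y c by (auto simp: shiftable_def u_def)
    have "inf u t \<notin> S" using y(3) by (simp add: u_def inf_assoc inf_commute[of t c])
    then have "sup u t \<in> S" "\<not> u \<le> t" using submod[of u t] u t by (auto simp: inf_absorb1)
    moreover have "sup (sup u t) c = sup t c"
      by (simp add: u_def sup_absorb2 le_supI2 sup_assoc le_infI2)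
    ultimately have "sup u t \<in> ?B" using t by (auto simp: le_supI2)
    then have "t = sup u t" using max by simp
    then show False using \<open>\<not> u \<le> t\<close> by (metis sup_ge1)
  qed
  then have "shiftable (flip c) (flip r)"
    unfolding shiftable_def by (metis flip_flip flip_in_iff flip_le_iff flip_sup)
  with c that show thesis by blast
qed

section \<open>Down-closed orientations of finite systems\<close>

lemma finite_orientation:
  assumes "finite S" "\<not> inconsistent {}"
  obtains A where "A \<subseteq> S" "\<And>x y. x \<in> A \<Longrightarrow> y \<in> S \<Longrightarrow> y \<le> x \<Longrightarrow> y \<in> A"
    "\<not> inconsistent A" "\<And>x. x \<in> S \<Longrightarrow> x \<in> A \<or> flip x \<in> A"
proof -
  define D where "D = {A. A \<subseteq> S \<and> (\<forall>x\<in>A. \<forall>y\<in>S. y \<le> x \<longrightarrow> y \<in> A) \<and> \<not> inconsistent A}"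
  have "\<exists>A\<in>D. \<forall>B\<in>D. A \<subseteq> B \<longrightarrow> A = B"
  proof (rule finite_has_maximal)
    show "finite D" using \<open>finite S\<close> by (auto simp: D_def intro: finite_subset[of _ "Pow S"])
    have "{} \<in> D" using assms by (simp add: D_def)
    then show "D \<noteq> {}" by blast
  qed
  then obtain A where A: "A \<in> D" and max: "\<And>B. B \<in> D \<Longrightarrow> A \<subseteq> B \<Longrightarrow> A = B" by blast
  have sub: "A \<subseteq> S" and down: "\<And>x y. x \<in> A \<Longrightarrow> y \<in> S \<Longrightarrow> y \<le> x \<Longrightarrow> y \<in> A"
    and cons: "\<not> inconsistent A" using A unfolding D_def by blast+
  \<comment> \<open>A minimal \<open>r\<close> outside \<open>A\<close> leaves
    \<open>insert r A\<close> down-closed, so by maximality of \<open>A\<close> only inconsistency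
    can exclude it.\<close>
  have below: "\<exists>r\<in>S. r \<le> x \<and> flip r \<in> forced A" if "x \<in> S" "x \<notin> A" for x
  proof -
    let ?B = "{r \<in> S - A. r \<le> x}"
    have "finite ?B" "?B \<noteq> {}" using that \<open>finite S\<close> by auto
    from finite_has_minimal[OF this] obtain r
      where r: "r \<in> ?B" and min: "\<And>b. b \<in> ?B \<Longrightarrow> b \<le> r \<Longrightarrow> b = r" by blast
    have "insert r A \<notin> D" using max[of "insert r A"] r by auto
    moreover have "y \<in> insert r A" if "y \<in> S" "y \<le> r" for y
      using min[of y] that r order_trans by blast
    ultimately have "inconsistent (insert r A)" using sub down r unfolding D_def by blast
    then show ?thesis using inconsistent_insertD[OF sub, of r] cons r by blast
  qed
  have orient: "x \<in> A \<or> flip x \<in> A" if "x \<in> S" for x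
  proof (rule ccontr)
    assume "\<not> ?thesis"
    then obtain r s where r: "r \<in> S" "r \<le> x" "flip r \<in> forced A"
      and s: "s \<in> S" "s \<le> flip x" "flip s \<in> forced A"
      using below[of x] below[of "flip x"] \<open>x \<in> S\<close> by (auto 0 3)
    have "r \<le> flip s" using r(2) s(2) by (meson flip_le_swap(2) order_trans)
    then obtain c where c: "r \<le> c" "c \<le> flip s" "shiftable c (flip s)" "shiftable (flip c) (flip r)"
      using shiftable_between[OF \<open>finite S\<close> r(1) flip_in[OF s(1)]] by blast
    \<comment> \<open>Since \<open>r \<le> c \<le> flip s\<close>, these shifted labels are
      \<open>c\<close> and \<open>flip c\<close>.\<close>
    have "inf (flip s) c \<in> forced A" "inf (flip r) (flip c) \<in> forced A"
      using forced_shift[OF sub down c(3) s(3)] forced_shift[OF sub down c(4) r(3)] by auto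
    then have "c \<in> forced A" "flip c \<in> forced A" using c(1,2) by (simp_all add: inf_absorb2)
    then show False using cons by (auto simp: inconsistent_def)
  qed
  show thesis using sub down cons orient by (rule that)
qed

section \<open>Uncrossing co-small triples\<close>

text \<open>By distributivity the new join is the old one met with an element above
  \<open>sup y (flip y)\<close>, and \<open>y\<close> lies below the old join.\<close>

lemma co_small_uncross:
  assumes "co_small flip (sup (sup x y) z)"
  shows "co_small flip (sup (sup (inf x (flip y)) y) z)"
proof -
  have "sup (sup (inf x (flip y)) y) z = inf (sup (sup x y) z) (sup (sup y (flip y)) z)"
    by (metis sup_commute sup_inf_distrib2)
  moreover have "co_small flip \<dots>"
  proof -
    have "inf (sup (sup x y) z) (sup y (flip y)) \<le> inf (sup (sup x y) z) (sup (sup y (flip y)) z)"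
      by (simp add: le_infI2 le_supI1)
    moreover have "y \<le> sup (sup x y) z" by (simp add: le_supI1)
    ultimately show ?thesis using co_small_inf_sup_flip[OF assms] co_small_mono by blast
  qed
  ultimately show ?thesis by simp
qed

text \<open>A triple with co-small join can be uncrossed within \<open>A\<close>, by passing to smaller elements,
  until it is a star.\<close>

lemma avoiding_if_consistent:
  assumes "finite S" "A \<subseteq> S" and down: "\<And>x y. x \<in> A \<Longrightarrow> y \<in> S \<Longrightarrow> y \<le> x \<Longrightarrow> y \<in> A"
    and cons: "\<not> inconsistent A"
  shows "avoiding flip A"
proof (rule ccontr)
  \<comment> \<open>A size that drops whenever an element of \<open>S\<close> is replaced by a
    smaller one; the induction is on the sum over the triple.\<close>
  define below where "below x = card {u \<in> S. u \<le> x}" for x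
  have below_less: "below u < below v" if "v \<in> S" "u < v" for u v
    unfolding below_def using that \<open>finite S\<close> by (intro psubset_card_mono) (auto simp: less_le_not_le intro: order_trans)
  have False if "x \<in> A" "y \<in> A" "z \<in> A" "co_small flip (sup (sup x y) z)" for x y z
    using that
  proof (induction "below x + below y + below z" arbitrary: x y z rule: less_induct)
    case less
    have IH: False if "x' \<in> A" "y' \<in> A" "z' \<in> A" "co_small flip (sup (sup x' y') z')"
      "below x' + below y' + below z' < below x + below y + below z" for x' y' z'
      using less.hyps[OF that(5) that(1-4)] .
    \<comment> \<open>If \<open>a\<close> and \<open>b\<close> cross, submodularity puts one of the
      corners \<open>inf a (flip b)\<close> and \<open>inf b (flip a)\<close> into \<open>S\<close>.
      It lies in \<open>A\<close> by down-closure and gives a smaller triple.\<close>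
    have uncross: "a = b \<or> a \<le> flip b"
      if "a \<in> A" "b \<in> A" "c \<in> A" and co: "co_small flip (sup (sup a b) c)"
        and m: "below a + below b + below c = below x + below y + below z" for a b c
    proof (rule ccontr)
      assume n: "\<not> ?thesis"
      have S: "a \<in> S" "b \<in> S" using that \<open>A \<subseteq> S\<close> by auto
      have "inf a (flip b) < a" "inf b (flip a) < b"
        using n flip_le_swap(2)[of b a] by (auto simp: less_le simp flip: le_iff_inf)
      then have bl: "below (inf a (flip b)) < below a" "below (inf b (flip a)) < below b"
        using below_less S by blast+
      have co': "co_small flip (sup (sup b a) c)" using co by (simp add: sup_commute)
      have "sup a (flip b) = flip (inf b (flip a))" by (simp add: flip_inf sup_commute)
      then have "inf a (flip b) \<in> S \<or> inf b (flip a) \<in> S"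
        using submod[of a "flip b"] S by auto
      then show False
      proof
        assume "inf a (flip b) \<in> S"
        then show False using IH[of "inf a (flip b)" b c] co_small_uncross[OF co] bl m that
            down[of a "inf a (flip b)"] by auto
      next
        assume "inf b (flip a) \<in> S"
        then show False using IH[of "inf b (flip a)" a c] co_small_uncross[OF co'] bl m that
            down[of b "inf b (flip a)"] by auto
      qed
    qed
    have S: "x \<in> S" "y \<in> S" "z \<in> S" using less.prems \<open>A \<subseteq> S\<close> by auto
    have "co_small flip (sup (sup x z) y)" "co_small flip (sup (sup y z) x)"
      using less.prems by (simp_all add: sup_commute sup_left_commute sup_assoc)
    then have "{x, y, z} \<in> stars"
      using uncross[of x y z] uncross[of x z y] uncross[of y z x] less.prems
      by (subst stars_iff) (auto simp: S)
    \<comment> \<open>A star inside \<open>A\<close> forces the inverse of each of its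
      elements.\<close>
    then have "flip x \<in> forced A"
      using forced.step[of "flip x" y z A] S less.prems by (auto intro: forced.base)
    then show False using cons less.prems by (auto simp: inconsistent_def intro: forced.base)
  qed
  moreover assume "\<not> avoiding flip A"
  ultimately show False by (auto simp: avoiding_def)
qed

section \<open>Tangles and their exclusion by trees\<close>

text \<open>If \<open>y \<le> x\<close>, then \<open>sup x (flip y)\<close> lies above the co-small
  \<open>sup y (flip y)\<close>, so an avoiding set cannot contain both \<open>x\<close> and
  \<open>flip y\<close>. This gives consistency and, for \<open>y = x\<close>, uniqueness of the
  orientation.\<close>

lemma abstract_tangle_iff:
  "abstract_tangle flip S A \<longleftrightarrow> A \<subseteq> S \<and> (\<forall>x\<in>S. x \<in> A \<or> flip x \<in> A) \<and> avoiding flip A"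
proof
  assume A: "abstract_tangle flip S A"
  then have "A \<subseteq> S" and or: "\<And>x. x \<in> S \<Longrightarrow> \<exists>!y. y \<in> {x, flip x} \<and> y \<in> A"
    and av: "\<And>\<sigma>. \<sigma> \<subseteq> A \<Longrightarrow> \<sigma> \<notin> co_small_triples flip"
    by (auto simp: abstract_tangle_def orientation_def separations_def unoriented_def)
  moreover have "x \<in> A \<or> flip x \<in> A" if "x \<in> S" for x using or[OF that] by blast
  moreover have "avoiding flip A"
    unfolding avoiding_def
  proof (intro ballI)
    fix r s t assume "r \<in> A" "s \<in> A" "t \<in> A"
    then show "\<not> co_small flip (sup (sup r s) t)"
      using av[of "{r, s, t}"] by (simp add: co_small_triples_iff)
  qed
  ultimately show "A \<subseteq> S \<and> (\<forall>x\<in>S. x \<in> A \<or> flip x \<in> A) \<and> avoiding flip A" by blast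
next
  assume A: "A \<subseteq> S \<and> (\<forall>x\<in>S. x \<in> A \<or> flip x \<in> A) \<and> avoiding flip A"
  have pair: "\<not> (x \<in> A \<and> flip y \<in> A)" if "y \<le> x" for x y
  proof
    assume "x \<in> A \<and> flip y \<in> A"
    moreover have "co_small flip (sup (sup x (flip y)) x)"
      using co_small_sup_flip by (rule co_small_mono[of "sup y (flip y)"]) (simp add: that le_supI1)
    ultimately show False using A by (auto simp: avoiding_def)
  qed
  have "orientation flip S A"
    using A pair[OF order_refl] unfolding orientation_def separations_def unoriented_def by blast
  moreover have "consistent flip S A"
    using pair unfolding consistent_def by blast
  moreover have "\<sigma> \<notin> co_small_triples flip" if "\<sigma> \<subseteq> A" for \<sigma>
    using A that by (auto simp: co_small_triples_def avoiding_def)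
  ultimately show "abstract_tangle flip S A" by (auto simp: abstract_tangle_def)
qed

lemma no_tangle_if_s_tree:
  assumes "has_s_tree_over flip S stars"
  shows "\<not> abstract_tangle flip S A"
proof
  assume A: "abstract_tangle flip S A"
  then have or: "\<And>x. x \<in> S \<Longrightarrow> \<exists>!y. y \<in> {x, flip x} \<and> y \<in> A"
    and av: "\<And>\<sigma>. \<sigma> \<subseteq> A \<Longrightarrow> \<sigma> \<notin> co_small_triples flip"
    by (auto simp: abstract_tangle_def orientation_def separations_def unoriented_def)
  obtain T :: "nat pair_pre_digraph" and \<alpha> where tree: "s_tree_over flip S stars T \<alpha>"
    using assms by (auto simp: has_s_tree_over_def)
  then have T: "undirected_tree T"
    and \<alpha>: "\<And>x y. (x, y) \<in> parcs T \<Longrightarrow> \<alpha> (x, y) \<in> S \<and> \<alpha> (y, x) = flip (\<alpha> (x, y))"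
    and F: "\<And>t. t \<in> pverts T \<Longrightarrow> \<alpha> ` in_arcs T t \<in> stars"
    by (auto simp: s_tree_over_def s_tree_def)
  interpret T: pair_graph T using T by (simp add: undirected_tree_def)
  let ?Q = "{e \<in> parcs T. \<alpha> e \<in> A}"
  have "\<exists>t\<in>pverts T. \<forall>y. (t, y) \<notin> ?Q"
  proof (rule undirected_tree_sink[OF T])
    fix x y assume "(x, y) \<in> ?Q"
    then show "(y, x) \<notin> ?Q" using \<alpha>[of x y] or[of "\<alpha> (x, y)"] nondegenerate[of "\<alpha> (x, y)"] by auto
  qed auto
  then obtain t where t: "t \<in> pverts T" "\<And>y. (t, y) \<notin> ?Q" by blast
  \<comment> \<open>No label leaving the sink \<open>t\<close> lies in the tangle, so all labels
    entering it do.\<close>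
  have "\<alpha> (x, t) \<in> A" if "(x, t) \<in> parcs T" for x
    using t(2)[of x] T.arcs_symmetric[OF that] \<alpha>[OF that] or[of "\<alpha> (x, t)"] by auto
  then have "\<alpha> ` in_arcs T t \<subseteq> A" by (auto simp: in_arcs_def)
  then show False using av F[OF t(1)] by (auto simp: co_small_triple_stars_def)
qed

subsection \<open>From forced separations to trees\<close>

text \<open>Trees on \<open>{..<n}\<close> with root \<open>0\<close> are given by their parent function \<open>p\<close>; \<open>l v\<close> is the label of
  the edge from \<open>v\<close> to \<open>p v\<close>, and the labels into \<open>0\<close> form the set \<open>Y\<close>.\<close>

definition labels_into :: "nat \<Rightarrow> (nat \<Rightarrow> nat) \<Rightarrow> (nat \<Rightarrow> 'u) \<Rightarrow> nat \<Rightarrow> 'u set" where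
  "labels_into n p l t = l ` {v. 0 < v \<and> v < n \<and> p v = t} \<union> (if t = 0 then {} else {flip (l t)})"

definition rooted_tree :: "nat \<Rightarrow> (nat \<Rightarrow> nat) \<Rightarrow> (nat \<Rightarrow> 'u) \<Rightarrow> 'u set \<Rightarrow> bool" where
  "rooted_tree n p l Y \<longleftrightarrow> 0 < n \<and> (\<forall>v. 0 < v \<and> v < n \<longrightarrow> p v < v \<and> l v \<in> S) \<and>
     labels_into n p l 0 = Y \<and> (\<forall>t. 0 < t \<and> t < n \<longrightarrow> labels_into n p l t \<in> stars)"

text \<open>The second tree is hung from the root of the first by an edge labelled \<open>y\<close>,
  whose inverse completes the star at the second root.\<close>

lemma rooted_tree_join:
  assumes 1: "rooted_tree n1 p1 l1 Y1" and 2: "rooted_tree n2 p2 l2 Y2"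
    and y: "y \<in> S" "insert (flip y) Y2 \<in> stars"
  shows "\<exists>n p l. rooted_tree n p l (insert y Y1)"
proof -
  define n where "n = n1 + n2"
  \<comment> \<open>Vertices of the second tree are shifted by \<open>n1\<close>, so parents stay
    smaller than children.\<close>
  define p where "p v = (if v < n1 then p1 v else if v = n1 then 0 else n1 + p2 (v - n1))" for v
  define l where "l v = (if v < n1 then l1 v else if v = n1 then y else l2 (v - n1))" for v
  have n: "0 < n1" "0 < n2" and p1: "\<And>v. 0 < v \<Longrightarrow> v < n1 \<Longrightarrow> p1 v < v"
    and p2: "\<And>v. 0 < v \<Longrightarrow> v < n2 \<Longrightarrow> p2 v < v"
    using 1 2 by (auto simp: rooted_tree_def)
  have lt: "p v < v \<and> l v \<in> S" if v: "0 < v" "v < n" for v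
  proof -
    consider "v < n1" | "v = n1" | w where "v = n1 + w" "0 < w" "w < n2"
      using v by (metis add_diff_inverse_nat n_def nat_add_left_cancel_less nat_neq_iff zero_less_diff)
    then show ?thesis using 1 2 v y by cases (auto simp: p_def l_def rooted_tree_def)
  qed
  have children: "{v. 0 < v \<and> v < n \<and> p v = t} = {v. 0 < v \<and> v < n1 \<and> p1 v = t} \<union>
    (if t = 0 then {n1} else {}) \<union> (+) n1 ` {w. 0 < w \<and> w < n2 \<and> n1 + p2 w = t}" (is "?L = ?R") for t
  proof (rule set_eqI)
    fix v
    consider "v < n1" | "v = n1" | w where "v = n1 + w" "0 < w"
      by (metis less_imp_add_positive nat_neq_iff)
    then show "v \<in> ?L \<longleftrightarrow> v \<in> ?R" using n by cases (auto simp: p_def n_def)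
  qed
  have image: "l ` {v. 0 < v \<and> v < n \<and> p v = t} = l1 ` {v. 0 < v \<and> v < n1 \<and> p1 v = t} \<union>
    (if t = 0 then {y} else {}) \<union> l2 ` {w. 0 < w \<and> w < n2 \<and> n1 + p2 w = t}" for t
  proof -
    have "l ` {v. 0 < v \<and> v < n1 \<and> p1 v = t} = l1 ` {v. 0 < v \<and> v < n1 \<and> p1 v = t}"
      by (rule image_cong) (auto simp: l_def)
    moreover have "l ` (+) n1 ` {w. 0 < w \<and> w < n2 \<and> n1 + p2 w = t} =
        l2 ` {w. 0 < w \<and> w < n2 \<and> n1 + p2 w = t}"
      unfolding image_image by (rule image_cong) (auto simp: l_def)
    ultimately show ?thesis unfolding children image_Un by (simp add: l_def)
  qed
  have left: "labels_into n p l t = labels_into n1 p1 l1 t \<union> (if t = 0 then {y} else {})" if "t < n1" for t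
  proof -
    have "{w. 0 < w \<and> w < n2 \<and> n1 + p2 w = t} = {}" using that by auto
    then show ?thesis unfolding labels_into_def image using that by (auto simp: l_def)
  qed
  have right: "labels_into n p l (n1 + u) = labels_into n2 p2 l2 u \<union> (if u = 0 then {flip y} else {})" for u
  proof -
    have "p1 v \<noteq> n1 + u" if "0 < v" "v < n1" for v using p1[OF that] that by linarith
    then have "{v. 0 < v \<and> v < n1 \<and> p1 v = n1 + u} = {}" by blast
    then show ?thesis unfolding labels_into_def image using n by (auto simp: l_def)
  qed
  have "labels_into n p l t \<in> stars" if t: "0 < t" "t < n" for t
  proof (cases "t < n1")
    case True
    then show ?thesis using left[of t] t 1 by (simp add: rooted_tree_def)
  next
    case False
    then obtain u where u: "t = n1 + u" "u < n2" using t(2) by (metis add_diff_inverse_nat n_def nat_add_left_cancel_less)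
    show ?thesis
    proof (cases "u = 0")
      case True
      then show ?thesis using u right[of 0] 2 y by (simp add: rooted_tree_def)
    next
      case False
      then show ?thesis using u right[of u] 2 by (simp add: rooted_tree_def)
    qed
  qed
  moreover have "labels_into n p l 0 = insert y Y1" using left[of 0] n 1 by (simp add: rooted_tree_def)
  ultimately have "rooted_tree n p l (insert y Y1)" using lt n by (auto simp: rooted_tree_def n_def)
  then show ?thesis by blast
qed

text \<open>The root lacks one edge; its label \<open>flip x\<close> completes the star there. The
  branches for \<open>y\<close> and \<open>z\<close> are attached one after the other.\<close>

lemma forced_rooted_tree:
  assumes "x \<in> forced {}"
  shows "\<exists>n p l Y. rooted_tree n p l Y \<and> insert (flip x) Y \<in> stars"
  using assms
proof induction
  case (step x y z)
  have attach: "\<exists>n p l Y. rooted_tree n p l Y \<and> insert (flip x) Y = insert (flip x) (insert u Y1)"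
    if "\<exists>n p l. rooted_tree n p l Y1" "u \<in> S"
      "u = flip x \<or> u \<in> forced {} \<and> (\<exists>n p l Y. rooted_tree n p l Y \<and> insert (flip u) Y \<in> stars)" for u Y1
  proof (cases "u = flip x")
    case True
    then show ?thesis using that(1) by auto
  next
    case False
    with that obtain n1 p1 l1 n2 p2 l2 Y2 where "rooted_tree n1 p1 l1 Y1" "rooted_tree n2 p2 l2 Y2"
      "insert (flip u) Y2 \<in> stars" by blast
    from rooted_tree_join[OF this(1,2) that(2) this(3)] show ?thesis by blast
  qed
  \<comment> \<open>A single vertex has no edges, so its parent function and labels are
    arbitrary.\<close>
  have "rooted_tree 1 id (\<lambda>_. x) {}" by (auto simp: rooted_tree_def labels_into_def)
  then obtain Y1 where Y1: "\<exists>n p l. rooted_tree n p l Y1" "insert (flip x) Y1 = insert (flip x) {y}"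
    using attach[of "{}" y] step.IH(1) step.hyps(2) by blast
  obtain n p l Y2 where Y2: "rooted_tree n p l Y2" "insert (flip x) Y2 = insert (flip x) (insert z Y1)"
    using attach[OF Y1(1) step.hyps(3)] step.IH(2) by blast
  have "insert (flip x) Y2 = {flip x, y, z}" using Y1(2) Y2(2) by blast
  then show ?case using Y2(1) step.hyps(4) by metis
qed simp

text \<open>The trees of \<open>flip x\<close> and \<open>x\<close> are joined by an edge labelled
  \<open>x\<close>, which completes the stars at both roots.\<close>

lemma s_tree_if_inconsistent:
  assumes "inconsistent {}"
  shows "has_s_tree_over flip S stars"
proof -
  obtain x where x: "x \<in> forced {}" "flip x \<in> forced {}"
    using assms by (auto simp: inconsistent_def)
  obtain n1 p1 l1 Y1 where 1: "rooted_tree n1 p1 l1 Y1" "insert x Y1 \<in> stars"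
    using forced_rooted_tree[OF x(2)] by auto
  obtain n2 p2 l2 Y2 where 2: "rooted_tree n2 p2 l2 Y2" "insert (flip x) Y2 \<in> stars"
    using forced_rooted_tree[OF x(1)] by auto
  have "x \<in> S" using forced_subset[of "{}"] x(1) by simp
  then obtain n p l where T: "rooted_tree n p l (insert x Y1)"
    using rooted_tree_join[OF 1(1) 2(1) _ 2(2)] by blast
  have n: "0 < n" and p: "\<And>v. 0 < v \<Longrightarrow> v < n \<Longrightarrow> p v < v"
    and l: "\<And>v. 0 < v \<Longrightarrow> v < n \<Longrightarrow> l v \<in> S"
    using T by (auto simp: rooted_tree_def)
  have stars: "labels_into n p l t \<in> stars" if "t < n" for t
    using T 1(2) that by (cases "t = 0") (auto simp: rooted_tree_def)
  let ?T = "parent_graph n p"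
  \<comment> \<open>Parents are smaller, so comparing the ends tells whether an arc points towards
    the root.\<close>
  define \<alpha> where "\<alpha> = (\<lambda>(a, b). if b < a then l a else flip (l b))"
  have arc: "\<alpha> (x, y) \<in> S \<and> \<alpha> (y, x) = flip (\<alpha> (x, y))" if "(x, y) \<in> parcs ?T" for x y
    using that p[of x] p[of y] l unfolding parent_graph_def \<alpha>_def by (auto dest: order.asym)
  have "\<alpha> ` in_arcs ?T t = labels_into n p l t" if "t < n" for t
  proof -
    have in_arcs: "in_arcs ?T t = (\<lambda>v. (v, t)) ` {v. 0 < v \<and> v < n \<and> p v = t} \<union> (if t = 0 then {} else {(p t, t)})"
      using that by (auto simp: in_arcs_def parent_graph_def)
    have "\<alpha> ` (\<lambda>v. (v, t)) ` {v. 0 < v \<and> v < n \<and> p v = t} = l ` {v. 0 < v \<and> v < n \<and> p v = t}"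
      unfolding image_image using p by (intro image_cong) (auto simp: \<alpha>_def)
    moreover have "\<alpha> (p t, t) = flip (l t)" if "t \<noteq> 0"
      using p[of t] that \<open>t < n\<close> by (auto simp: \<alpha>_def)
    ultimately show ?thesis unfolding in_arcs labels_into_def image_Un by simp
  qed
  then have "s_tree_over flip S stars ?T \<alpha>"
    using arc stars undirected_tree_parent_graph[OF n p]
    by (auto simp: s_tree_over_def s_tree_def) (auto simp: parent_graph_def)
  then show ?thesis by (auto simp: has_s_tree_over_def)
qed

lemma finite_tangle:
  assumes "finite S" "\<not> has_s_tree_over flip S stars"
  shows "\<exists>A\<subseteq>S. (\<forall>x\<in>S. x \<in> A \<or> flip x \<in> A) \<and> avoiding flip A"
proof -
  have "\<not> inconsistent {}" using assms(2) s_tree_if_inconsistent by blast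
  from finite_orientation[OF assms(1) this] avoiding_if_consistent[OF assms(1)]
  show ?thesis by metis
qed

subsection \<open>Compactness\<close>

text \<open>The sublattice generated by \<open>F\<close> and its inverses is finite and closed under
  \<open>flip\<close>. Its intersection with \<open>S\<close> stays submodular, and any tree over it
  is a tree over \<open>S\<close>.\<close>

lemma locally_tangle:
  assumes "finite F" "F \<subseteq> S" "\<not> has_s_tree_over flip S stars"
  shows "\<exists>A\<subseteq>S. (\<forall>x\<in>F. x \<in> A \<or> flip x \<in> A) \<and> avoiding flip A"
proof -
  define L where "L = sublattice (F \<union> flip ` F)"
  have "finite L" unfolding L_def using assms(1) by (intro finite_sublattice) simp
  have L_flip: "flip x \<in> L" if "x \<in> L" for x
    using that unfolding L_def
  proof induction
    case (base x)
    then show ?case by (auto intro: sublattice.base)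
  next
    case (sup x y)
    then show ?case by (simp add: flip_sup sublattice.inf)
  next
    case (inf x y)
    then show ?case by (simp add: flip_inf sublattice.sup)
  qed
  interpret L: separations_in_universe flip "L \<inter> S"
  proof
    fix s t assume "s \<in> L \<inter> S" "t \<in> L \<inter> S"
    then show "sup s t \<in> L \<inter> S \<or> inf s t \<in> L \<inter> S"
      using submod[of s t] by (auto simp: L_def intro: sublattice.sup sublattice.inf)
  qed (auto simp: flip_mono L_flip dest: nondegenerate)
  have "\<not> has_s_tree_over flip (L \<inter> S) stars"
    using has_s_tree_over_mono[of "L \<inter> S" S] assms(3) by blast
  then obtain A where A: "A \<subseteq> L \<inter> S" "\<forall>x\<in>L \<inter> S. x \<in> A \<or> flip x \<in> A" "avoiding flip A"
    using L.finite_tangle \<open>finite L\<close> by blast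
  have "F \<subseteq> L \<inter> S" using assms(2) by (auto simp: L_def intro: sublattice.base)
  then have "\<forall>x\<in>F. x \<in> A \<or> flip x \<in> A" using A(2) by (meson subsetD)
  with A(1,3) show ?thesis by (intro exI[of _ A]) simp
qed

text \<open>Zorn's lemma applies because each condition involves only finitely many separations at a
  time.\<close>

lemma tangle_compactness:
  assumes loc: "\<And>F. finite F \<Longrightarrow> F \<subseteq> S \<Longrightarrow> \<exists>A\<subseteq>S. (\<forall>x\<in>F. x \<in> A \<or> flip x \<in> A) \<and> avoiding flip A"
  shows "\<exists>A\<subseteq>S. (\<forall>x\<in>S. x \<in> A \<or> flip x \<in> A) \<and> avoiding flip A"
proof -
  define good where "good F A B \<longleftrightarrow>
    A \<inter> F \<subseteq> B \<and> B \<subseteq> S \<and> (\<forall>x\<in>F. x \<in> B \<or> flip x \<in> B) \<and> avoiding flip B" for F A B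
  \<comment> \<open>a maximal set all of whose finite parts extend to local tangles is a tangle\<close>
  define P where "P = {A. A \<subseteq> S \<and> (\<forall>F. finite F \<and> F \<subseteq> S \<longrightarrow> (\<exists>B. good F A B))}"
  have "{} \<in> P" using loc by (fastforce simp: P_def good_def)
  moreover have "\<Union>\<C> \<in> P" if "\<C> \<noteq> {}" "subset.chain P \<C>" for \<C>
  proof -
    have "\<exists>B. good F (\<Union>\<C>) B" if F: "finite F" "F \<subseteq> S" for F
    proof -
      \<comment> \<open>Only the finite part in \<open>F\<close> matters, and one member of the
        chain contains it.\<close>
      obtain C where "C \<in> \<C>" "\<Union>\<C> \<inter> F \<subseteq> C"
        using finite_subset_Union_chain[of "\<Union>\<C> \<inter> F" \<C> P] \<open>\<C> \<noteq> {}\<close> \<open>subset.chain P \<C>\<close> F(1) by auto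
      moreover have "C \<in> P" using \<open>C \<in> \<C>\<close> \<open>subset.chain P \<C>\<close> by (auto simp: subset_chain_def)
      then obtain B where "good F C B" using F by (auto simp: P_def)
      ultimately have "good F (\<Union>\<C>) B" by (auto simp: good_def)
      then show ?thesis ..
    qed
    moreover have "\<Union>\<C> \<subseteq> S" using \<open>subset.chain P \<C>\<close> by (auto simp: subset_chain_def P_def)
    ultimately show ?thesis by (auto simp: P_def)
  qed
  ultimately obtain A where A: "A \<in> P" and max: "\<And>B. B \<in> P \<Longrightarrow> A \<subseteq> B \<Longrightarrow> B = A"
    using subset_Zorn_nonempty[of P] by blast
  have good: "\<exists>B. good F A B" if "finite F" "F \<subseteq> S" for F using A that by (auto simp: P_def)
  have "A \<subseteq> S" using A by (auto simp: P_def)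
  have "x \<in> A \<or> flip x \<in> A" if "x \<in> S" for x
  proof (rule ccontr)
    assume n: "\<not> ?thesis"
    have bad: "\<exists>F. finite F \<and> F \<subseteq> S \<and> (\<forall>B. \<not> good F (insert y A) B)" if "y \<in> S" "y \<notin> A" for y
    proof -
      have "insert y A \<notin> P" using max that by blast
      then show ?thesis using \<open>A \<subseteq> S\<close> that(1) unfolding P_def by blast
    qed
    obtain F1 where F1: "finite F1" "F1 \<subseteq> S" "\<And>B. \<not> good F1 (insert x A) B"
      using bad n \<open>x \<in> S\<close> by meson
    obtain F2 where F2: "finite F2" "F2 \<subseteq> S" "\<And>B. \<not> good F2 (insert (flip x) A) B"
      using bad n flip_in[OF \<open>x \<in> S\<close>] by meson
    \<comment> \<open>A local tangle for both obstructions and \<open>x\<close> must orient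
      \<open>x\<close>, which refutes one of the obstructions.\<close>
    obtain B where B: "good (insert x (F1 \<union> F2)) A B"
      using good[of "insert x (F1 \<union> F2)"] F1 F2 \<open>x \<in> S\<close> by auto
    then have "x \<in> B \<or> flip x \<in> B" by (auto simp: good_def)
    then have "good F1 (insert x A) B \<or> good F2 (insert (flip x) A) B"
      using B by (auto simp: good_def)
    then show False using F1(3) F2(3) by blast
  qed
  moreover have "avoiding flip A"
    unfolding avoiding_def
  proof (intro ballI)
    fix r s t assume *: "r \<in> A" "s \<in> A" "t \<in> A"
    then obtain B where "good {r, s, t} A B" using good[of "{r, s, t}"] \<open>A \<subseteq> S\<close> by auto
    then show "\<not> co_small flip (sup (sup r s) t)" using * by (auto simp: good_def avoiding_def)
  qed
  ultimately show ?thesis using \<open>A \<subseteq> S\<close> by blast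
qed

end

theorem theorem2:
  fixes flip :: "'u::distrib_lattice \<Rightarrow> 'u"
    and S :: "'u set"
  assumes "distributive_universe flip"
    and "separation_system_in flip S"
    and "submodular S"
    and "\<forall>s\<in>S. \<not> degenerate flip s"
  shows "(\<exists>O'. abstract_tangle flip S O') \<longleftrightarrow>
         \<not> has_s_tree_over flip S (co_small_triple_stars flip)"
proof -
  interpret separations_in_universe flip S
    using assms by unfold_locales
      (auto simp: distributive_universe_def universe_def separation_system_def
        separation_system_in_def submodular_def degenerate_def)
  show ?thesis
  proof
    assume "\<exists>O'. abstract_tangle flip S O'"
    then show "\<not> has_s_tree_over flip S stars" using no_tangle_if_s_tree by blast
  next
    assume "\<not> has_s_tree_over flip S stars"
    then show "\<exists>O'. abstract_tangle flip S O'"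
      using tangle_compactness locally_tangle unfolding abstract_tangle_iff by metis
  qed
qed

end
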